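(* Let $\lambda\neq0$ be a real number and let $X=f_1e_1+f_2e_2+f_3e_3$ be a vector field on $(H_3,g_1)$, where $f_1,f_2,f_3$ are smooth real functions of $(x,y,z)\in\mathbb{R}^3$. Then $X$ is an affine vector field on $(H_3,g_1)$ if and only if there exist real constants $c_1,c_2,c_3,c_4$ such that $$\begin{cases} f_1(x,y,z)=\frac{c_1}{2}y^2-\frac{c_1}{2\lambda^2}x^2+c_3x+c_2y+c_4,\\ f_2(x,y,z)=-\frac{c_1}{\lambda^2}x+c_3,\\ f_3(x,y,z)=-\frac{1}{\lambda}(c_1y+c_2).\end{cases}$$
   Context: The Heisenberg group $H_3$ is $\mathbb{R}^3$ with global coordinates $(x,y,z)$ and multiplication $(x,y,z)(\tilde x,\tilde y,\tilde z)=(x+\tilde x,y+\tilde y,z+\tilde z-x\tilde y)$. For $\lambda\neq0$, $g_1$ is the left-invariant Lorentzian metric $g_1=-\frac{1}{\lambda^2}dx^2+dy^2+(x\,dy+dz)^2$, with left-invariant orthonormal frame $e_1=\partial_z$, $e_2=\partial_y-x\partial_z$, $e_3=\lambda\partial_x$ ($e_3$ timelike). A smooth vector field $X$ on a pseudo-Riemannian manifold $(M,g)$ with Levi-Civita connection $\nabla$ is affine if $\mathcal{L}_X\nabla=0$, i.e. $[X,\nabla_YZ]=\nabla_{[X,Y]}Z+\nabla_Y[X,Z]$ for all vector fields $Y,Z$. *)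

theory Defs
  imports "HOL-Analysis.Analysis"
begin

section \<open>Smooth functions and vector fields on a Euclidean space\<close>

primrec Ck :: "nat \<Rightarrow> ('a::real_normed_vector \<Rightarrow> 'b::real_normed_vector) \<Rightarrow> bool" where
  "Ck 0 f \<longleftrightarrow> continuous_on UNIV f"
| "Ck (Suc k) f \<longleftrightarrow>
     (\<forall>p. f differentiable (at p)) \<and> (\<forall>v. Ck k (\<lambda>p. frechet_derivative f (at p) v))"

definition smooth :: "('a::real_normed_vector \<Rightarrow> 'b::real_normed_vector) \<Rightarrow> bool" where
  "smooth f \<longleftrightarrow> (\<forall>k. Ck k f)"

text \<open>A vector field is identified with its component function in the global coordinates,
  i.e. with a map from the space to itself.\<close>

type_synonym 'a vfield = "'a \<Rightarrow> 'a"

text \<open>The derivative of \<open>f\<close> (scalar, or vector-valued and then taken componentwise in the global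
  coordinates) along the vector field \<open>X\<close>.\<close>

definition along :: "'a vfield \<Rightarrow> ('a \<Rightarrow> 'b) \<Rightarrow> 'a::real_normed_vector \<Rightarrow> 'b::real_normed_vector" where
  "along X f p = frechet_derivative f (at p) (X p)"

definition lie_bracket :: "'a vfield \<Rightarrow> 'a vfield \<Rightarrow> 'a::real_normed_vector vfield" where
  "lie_bracket X Y p = along X Y p - along Y X p"


section \<open>The Levi-Civita connection and affine vector fields\<close>

definition connection ::
  "('a vfield \<Rightarrow> 'a vfield \<Rightarrow> 'a::real_normed_vector vfield) \<Rightarrow> bool" where
  "connection nabla \<longleftrightarrow>
     (\<forall>X Y. smooth X \<longrightarrow> smooth Y \<longrightarrow> smooth (nabla X Y)) \<and>
     (\<forall>X X' Y. smooth X \<longrightarrow> smooth X' \<longrightarrow> smooth Y \<longrightarrow>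
        nabla (\<lambda>p. X p + X' p) Y = (\<lambda>p. nabla X Y p + nabla X' Y p)) \<and>
     (\<forall>(\<phi>::'a \<Rightarrow> real) X Y. smooth \<phi> \<longrightarrow> smooth X \<longrightarrow> smooth Y \<longrightarrow>
        nabla (\<lambda>p. \<phi> p *\<^sub>R X p) Y = (\<lambda>p. \<phi> p *\<^sub>R nabla X Y p)) \<and>
     (\<forall>X Y Y'. smooth X \<longrightarrow> smooth Y \<longrightarrow> smooth Y' \<longrightarrow>
        nabla X (\<lambda>p. Y p + Y' p) = (\<lambda>p. nabla X Y p + nabla X Y' p)) \<and>
     (\<forall>(\<phi>::'a \<Rightarrow> real) X Y. smooth \<phi> \<longrightarrow> smooth X \<longrightarrow> smooth Y \<longrightarrow>
        nabla X (\<lambda>p. \<phi> p *\<^sub>R Y p) = (\<lambda>p. along X \<phi> p *\<^sub>R Y p + \<phi> p *\<^sub>R nabla X Y p))"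

definition torsion_free ::
  "('a vfield \<Rightarrow> 'a vfield \<Rightarrow> 'a::real_normed_vector vfield) \<Rightarrow> bool" where
  "torsion_free nabla \<longleftrightarrow> (\<forall>X Y. smooth X \<longrightarrow> smooth Y \<longrightarrow>
     (\<forall>p. nabla X Y p - nabla Y X p = lie_bracket X Y p))"

definition metric_compatible :: "('a \<Rightarrow> 'a \<Rightarrow> 'a \<Rightarrow> real) \<Rightarrow>
    ('a vfield \<Rightarrow> 'a vfield \<Rightarrow> 'a::real_normed_vector vfield) \<Rightarrow> bool" where
  "metric_compatible g nabla \<longleftrightarrow> (\<forall>X Y Z. smooth X \<longrightarrow> smooth Y \<longrightarrow> smooth Z \<longrightarrow>
     (\<forall>p. along X (\<lambda>q. g q (Y q) (Z q)) p
            = g p (nabla X Y p) (Z p) + g p (Y p) (nabla X Z p)))"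

definition is_levi_civita :: "('a \<Rightarrow> 'a \<Rightarrow> 'a \<Rightarrow> real) \<Rightarrow>
    ('a vfield \<Rightarrow> 'a vfield \<Rightarrow> 'a::real_normed_vector vfield) \<Rightarrow> bool" where
  "is_levi_civita g nabla \<longleftrightarrow> connection nabla \<and> torsion_free nabla \<and> metric_compatible g nabla"

text \<open>A connection is only meaningful on smooth fields; the value \<open>0\<close> elsewhere is a convention
  which makes the description unique.\<close>

definition levi_civita :: "('a \<Rightarrow> 'a \<Rightarrow> 'a \<Rightarrow> real) \<Rightarrow>
    'a vfield \<Rightarrow> 'a vfield \<Rightarrow> 'a::real_normed_vector vfield" where
  "levi_civita g = (THE nabla. is_levi_civita g nabla \<and>
     (\<forall>X Y. \<not> (smooth X \<and> smooth Y) \<longrightarrow> nabla X Y = (\<lambda>_. 0)))"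

definition affine_field ::
  "('a vfield \<Rightarrow> 'a vfield \<Rightarrow> 'a vfield) \<Rightarrow> 'a::real_normed_vector vfield \<Rightarrow> bool" where
  "affine_field nabla X \<longleftrightarrow> smooth X \<and> (\<forall>Y Z. smooth Y \<longrightarrow> smooth Z \<longrightarrow>
     (\<forall>p. lie_bracket X (nabla Y Z) p
            = nabla (lie_bracket X Y) Z p + nabla Y (lie_bracket X Z) p))"


section \<open>The Heisenberg group\<close>

type_synonym r3 = "real \<times> real \<times> real"

definition heis_mult :: "r3 \<Rightarrow> r3 \<Rightarrow> r3" where
  "heis_mult = (\<lambda>(x, y, z) (x', y', z'). (x + x', y + y', z + z' - x * y'))"

definition g1 :: "real \<Rightarrow> r3 \<Rightarrow> r3 \<Rightarrow> r3 \<Rightarrow> real" where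
  "g1 lam = (\<lambda>(x, y, z) (u1, u2, u3) (v1, v2, v3).
     - (1 / lam\<^sup>2) * (u1 * v1) + u2 * v2 + (x * u2 + u3) * (x * v2 + v3))"

definition e1 :: "r3 vfield" where
  "e1 = (\<lambda>(x, y, z). (0, 0, 1))"

definition e2 :: "r3 vfield" where
  "e2 = (\<lambda>(x, y, z). (0, 1, - x))"

definition e3 :: "real \<Rightarrow> r3 vfield" where
  "e3 lam = (\<lambda>(x, y, z). (lam, 0, 0))"

lemma g1_frame:
  assumes "lam \<noteq> 0"
  shows "g1 lam p (e1 p) (e1 p) = 1" "g1 lam p (e2 p) (e2 p) = 1"
    "g1 lam p (e3 lam p) (e3 lam p) = -1" "g1 lam p (e1 p) (e2 p) = 0"
    "g1 lam p (e1 p) (e3 lam p) = 0" "g1 lam p (e2 p) (e3 lam p) = 0"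
  using assms by (cases p; simp add: g1_def e1_def e2_def e3_def power2_eq_square)+

lemma heis_left_translation_derivative:
  "(heis_mult (a, b, c) has_derivative (\<lambda>(u1, u2, u3). (u1, u2, u3 - a * u2))) (at p)"
proof -
  have eq: "heis_mult (a, b, c)
      = (\<lambda>q. (a + fst q, b + fst (snd q), c + snd (snd q) - a * fst (snd q)))"
    by (auto simp: heis_mult_def fun_eq_iff)
  show ?thesis unfolding eq
    by (auto intro!: derivative_eq_intros simp: case_prod_unfold)
qed

lemma heis_left_invariance:
  fixes h p u v :: r3
  defines "dL \<equiv> frechet_derivative (heis_mult h) (at p)"
  shows "g1 lam (heis_mult h p) (dL u) (dL v) = g1 lam p u v"
    "dL (e1 p) = e1 (heis_mult h p)" "dL (e2 p) = e2 (heis_mult h p)"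
    "dL (e3 lam p) = e3 lam (heis_mult h p)"
proof -
  obtain a b c where h: "h = (a, b, c)" by (cases h)
  have dL: "dL = (\<lambda>(u1, u2, u3). (u1, u2, u3 - a * u2))"
    unfolding dL_def h
    using frechet_derivative_at[OF heis_left_translation_derivative] by metis
  show "g1 lam (heis_mult h p) (dL u) (dL v) = g1 lam p u v"
    "dL (e1 p) = e1 (heis_mult h p)" "dL (e2 p) = e2 (heis_mult h p)"
    "dL (e3 lam p) = e3 lam (heis_mult h p)"
    unfolding dL h
    by (cases p; cases u; cases v;
        simp add: g1_def e1_def e2_def e3_def heis_mult_def algebra_simps)+
qed


section \<open>Closure properties of smoothness\<close>

lemma Ck_Suc_imp: "Ck (Suc k) f \<Longrightarrow> Ck k f"
proof (induction k arbitrary: f)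
  case 0
  then show ?case
    by (auto simp: continuous_on_eq_continuous_at intro: differentiable_imp_continuous_within)
next
  case (Suc k)
  then show ?case by auto
qed

lemma Ck_const: "Ck k (\<lambda>p. c)"
  by (induction k arbitrary: c) auto

lemma Ck_SucI:
  assumes "\<And>p. (f has_derivative D p) (at p)" "\<And>v. Ck k (\<lambda>p. D p v)"
  shows "Ck (Suc k) f"
proof -
  have "frechet_derivative f (at p) = D p" for p
    using frechet_derivative_at[OF assms(1)] by (rule sym)
  then show ?thesis
    using assms(2) differentiableI[OF assms(1)] by simp
qed

lemma Ck_SucD:
  assumes "Ck (Suc k) f"
  shows "(f has_derivative frechet_derivative f (at p)) (at p)"
    "Ck k (\<lambda>p. frechet_derivative f (at p) v)" "Ck k f"
  using assms Ck_Suc_imp[OF assms] frechet_derivative_works[of f "at p"] by simp_all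

lemma Ck_bounded_linear: "bounded_linear L \<Longrightarrow> Ck k f \<Longrightarrow> Ck k (\<lambda>p. L (f p))"
proof (induction k arbitrary: f)
  case 0
  then show ?case by (simp add: bounded_linear.continuous_on)
next
  case (Suc k)
  show ?case
    by (rule Ck_SucI[OF bounded_linear.has_derivative[OF Suc.prems(1) Ck_SucD(1)[OF Suc.prems(2)]]
          Suc.IH[OF Suc.prems(1) Ck_SucD(2)[OF Suc.prems(2)]]])
qed

lemma Ck_add: "Ck k f \<Longrightarrow> Ck k g \<Longrightarrow> Ck k (\<lambda>p. f p + g p)"
proof (induction k arbitrary: f g)
  case 0
  then show ?case by (simp add: continuous_on_add)
next
  case (Suc k)
  show ?case
    by (rule Ck_SucI[OF has_derivative_add[OF Suc.prems[THEN Ck_SucD(1)]]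
          Suc.IH[OF Suc.prems[THEN Ck_SucD(2)]]])
qed

lemma Ck_bounded_bilinear: "bounded_bilinear b \<Longrightarrow> Ck k f \<Longrightarrow> Ck k g \<Longrightarrow> Ck k (\<lambda>p. b (f p) (g p))"
proof (induction k arbitrary: f g)
  case 0
  then show ?case by (simp add: bounded_bilinear.continuous_on)
next
  case (Suc k)
  note b = Suc.prems(1) and f = Ck_SucD[OF Suc.prems(2)] and g = Ck_SucD[OF Suc.prems(3)]
  show ?case
    by (rule Ck_SucI[OF bounded_bilinear.FDERIV[OF b f(1) g(1)]
          Ck_add[OF Suc.IH[OF b f(3) g(2)] Suc.IH[OF b f(2) g(3)]]])
qed

lemma smooth_const: "smooth (\<lambda>p. c)"
  by (simp add: smooth_def Ck_const)

lemma smooth_bounded_linear: "bounded_linear L \<Longrightarrow> smooth f \<Longrightarrow> smooth (\<lambda>p. L (f p))"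
  by (simp add: smooth_def Ck_bounded_linear)

lemma smooth_add: "smooth f \<Longrightarrow> smooth g \<Longrightarrow> smooth (\<lambda>p. f p + g p)"
  by (simp add: smooth_def Ck_add)

lemma smooth_bounded_bilinear:
  "bounded_bilinear b \<Longrightarrow> smooth f \<Longrightarrow> smooth g \<Longrightarrow> smooth (\<lambda>p. b (f p) (g p))"
  by (simp add: smooth_def Ck_bounded_bilinear)

lemma smooth_differentiable: "smooth f \<Longrightarrow> f differentiable (at p)"
  unfolding smooth_def using Ck.simps(2) by blast

lemma smooth_has_derivative: "smooth f \<Longrightarrow> (f has_derivative frechet_derivative f (at p)) (at p)"
  using smooth_differentiable frechet_derivative_works by blast

lemma smooth_directional: "smooth f \<Longrightarrow> smooth (\<lambda>p. frechet_derivative f (at p) v)"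
  unfolding smooth_def using Ck.simps(2) by blast

lemma smooth_ident: "smooth (\<lambda>p. p)"
proof -
  have "Ck k (\<lambda>p::'a. p)" for k by (cases k) (auto simp: Ck_const)
  then show ?thesis by (simp add: smooth_def)
qed

lemmas smooth_fst = smooth_bounded_linear[OF bounded_linear_fst]
  and smooth_snd = smooth_bounded_linear[OF bounded_linear_snd]
  and smooth_mult = smooth_bounded_bilinear[OF bounded_bilinear_mult]
  and smooth_scaleR = smooth_bounded_bilinear[OF bounded_bilinear_scaleR]
  and smooth_minus = smooth_bounded_linear[OF bounded_linear_minus[OF bounded_linear_ident]]

lemma smooth_diff: "smooth f \<Longrightarrow> smooth g \<Longrightarrow> smooth (\<lambda>p. f p - g p)"
  using smooth_add[of f "\<lambda>p. - g p"] smooth_minus[of g] by simp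

lemma smooth_Pair: "smooth f \<Longrightarrow> smooth g \<Longrightarrow> smooth (\<lambda>p. (f p, g p))"
  using smooth_add[OF smooth_bounded_linear[of "\<lambda>a. (a, 0)" f]
      smooth_bounded_linear[of "\<lambda>a. (0, a)" g]]
  by (simp add: bounded_linear_Pair bounded_linear_ident bounded_linear_zero)

lemma smooth_sum: "finite A \<Longrightarrow> (\<And>i. i \<in> A \<Longrightarrow> smooth (f i)) \<Longrightarrow> smooth (\<lambda>p. \<Sum>i\<in>A. f i p)"
  by (induction A rule: finite_induct) (auto intro: smooth_add smooth_const)

lemma smooth_along:
  fixes X :: "'a::euclidean_space vfield"
  assumes X: "smooth X" and f: "smooth f"
  shows "smooth (along X f)"
proof -
  have eq: "along X f = (\<lambda>p. \<Sum>b\<in>Basis. (X p \<bullet> b) *\<^sub>R frechet_derivative f (at p) b)"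
  proof
    fix p
    interpret linear "frechet_derivative f (at p)"
      by (rule linear_frechet_derivative[OF smooth_differentiable[OF f]])
    have "frechet_derivative f (at p) (X p)
        = frechet_derivative f (at p) (\<Sum>b\<in>Basis. (X p \<bullet> b) *\<^sub>R b)"
      by (simp add: euclidean_representation)
    then show "along X f p = (\<Sum>b\<in>Basis. (X p \<bullet> b) *\<^sub>R frechet_derivative f (at p) b)"
      unfolding along_def by (simp add: sum scale)
  qed
  show ?thesis unfolding eq
    by (intro smooth_sum finite_Basis smooth_scaleR smooth_directional f
        smooth_bounded_linear[OF bounded_linear_inner_left] X)
qed

lemma smooth_lie_bracket:
  fixes X :: "'a::euclidean_space vfield"
  shows "smooth X \<Longrightarrow> smooth Y \<Longrightarrow> smooth (lie_bracket X Y)"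
  unfolding lie_bracket_def[abs_def] by (intro smooth_diff smooth_along)


section \<open>Uniqueness of the Levi-Civita connection\<close>

lemma koszul:
  fixes X :: "'a::euclidean_space vfield"
  assumes sym: "\<And>p u v. g p u v = g p v u" and lin: "\<And>p u. linear (g p u)"
    and LC: "is_levi_civita g nabla" and s: "smooth X" "smooth Y" "smooth Z"
  shows "2 * g p (nabla X Y p) (Z p) =
      along X (\<lambda>q. g q (Y q) (Z q)) p + along Y (\<lambda>q. g q (X q) (Z q)) p
      - along Z (\<lambda>q. g q (X q) (Y q)) p
      + g p (lie_bracket X Y p) (Z p) - g p (lie_bracket X Z p) (Y p)
      - g p (lie_bracket Y Z p) (X p)"
proof -
  have diff: "g p (a - b) c = g p a c - g p b c" for a b c
    using linear_diff[OF lin[of p c]] by (simp add: sym[of p _ c])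
  have t: "nabla A B p - nabla B A p = lie_bracket A B p" if "smooth A" "smooth B" for A B
    using LC that by (auto simp: is_levi_civita_def torsion_free_def)
  have m: "along A (\<lambda>q. g q (B q) (C q)) p = g p (nabla A B p) (C p) + g p (B p) (nabla A C p)"
    if "smooth A" "smooth B" "smooth C" for A B C
    using LC that by (auto simp: is_levi_civita_def metric_compatible_def)
  show ?thesis
    using s by (simp add: t[symmetric] m diff sym[of p "X p"] sym[of p "Y p"] sym[of p "Z p"])
qed

lemma levi_civita_eqI:
  fixes g :: "'a::euclidean_space \<Rightarrow> 'a \<Rightarrow> 'a \<Rightarrow> real"
  assumes sym: "\<And>p u v. g p u v = g p v u" and lin: "\<And>p u. linear (g p u)"
    and nondeg: "\<And>p u. (\<And>v. g p u v = 0) \<Longrightarrow> u = 0"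
    and LC: "is_levi_civita g nabla"
      "\<And>X Y. \<not> (smooth X \<and> smooth Y) \<Longrightarrow> nabla X Y = (\<lambda>_. 0)"
  shows "levi_civita g = nabla"
  unfolding levi_civita_def
proof (rule the_equality)
  show "is_levi_civita g nabla \<and> (\<forall>X Y. \<not> (smooth X \<and> smooth Y) \<longrightarrow> nabla X Y = (\<lambda>_. 0))"
    using LC by blast
next
  fix D
  assume D: "is_levi_civita g D \<and> (\<forall>X Y. \<not> (smooth X \<and> smooth Y) \<longrightarrow> D X Y = (\<lambda>_. 0))"
  have "D X Y p = nabla X Y p" if s: "smooth X" "smooth Y" for X Y p
  proof -
    have "g p (D X Y p - nabla X Y p) v = 0" for v
    proof -
      have "g p (D X Y p) v = g p (nabla X Y p) v"
      proof -
        have DLC: "is_levi_civita g D" using D by blast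
        have "2 * g p (D X Y p) v = 2 * g p (nabla X Y p) v"
          by (rule trans[OF koszul[OF sym lin DLC s smooth_const[of v]]
                koszul[OF sym lin LC(1) s smooth_const[of v], symmetric]])
        then show ?thesis by simp
      qed
      then show ?thesis
        using linear_diff[OF lin[of p v]] by (simp add: sym[of p _ v])
    qed
    then have "D X Y p - nabla X Y p = 0" by (rule nondeg)
    then show ?thesis by simp
  qed
  moreover have "D X Y p = nabla X Y p" if "\<not> (smooth X \<and> smooth Y)" for X Y p
    using D LC(2)[OF that] that by presburger
  ultimately have "D X Y p = nabla X Y p" for X Y p by blast
  then show "D = nabla" by (simp add: fun_eq_iff)
qed


section \<open>The Levi-Civita connection of \<open>g1\<close>\<close>

text \<open>Twice the Christoffel symbols of \<open>g1\<close>, as a bilinear map at each point.\<close>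

definition christoffel1 :: "real \<Rightarrow> r3 \<Rightarrow> r3 \<Rightarrow> r3 \<Rightarrow> r3" where
  "christoffel1 lam = (\<lambda>(x, y, z) (u1, u2, u3) (v1, v2, v3).
     (lam\<^sup>2 * (2 * x * (u2 * v2) + u2 * v3 + u3 * v2),
      x * (u1 * v2 + u2 * v1) + u1 * v3 + u3 * v1,
      (1 - x * x) * (u1 * v2 + u2 * v1) - x * (u1 * v3 + u3 * v1)))"

definition nabla1 :: "real \<Rightarrow> r3 vfield \<Rightarrow> r3 vfield \<Rightarrow> r3 vfield" where
  "nabla1 lam X Y = (if smooth X \<and> smooth Y
     then (\<lambda>p. along X Y p + (1 / 2) *\<^sub>R christoffel1 lam p (X p) (Y p)) else (\<lambda>_. 0))"

lemma smooth_christoffel1: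
  assumes "smooth X" "smooth Y"
  shows "smooth (\<lambda>p. christoffel1 lam p (X p) (Y p))"
  unfolding christoffel1_def case_prod_unfold
  by (intro smooth_Pair smooth_add smooth_diff smooth_mult smooth_fst smooth_snd smooth_const
      smooth_ident assms)

lemma along_eqI: "(f has_derivative D) (at p) \<Longrightarrow> along X f p = D (X p)"
  by (simp add: along_def frechet_derivative_at[symmetric])

lemma along_add:
  assumes "smooth f" "smooth g"
  shows "along X (\<lambda>q. f q + g q) p = along X f p + along X g p"
  using along_eqI[OF has_derivative_add[OF assms[THEN smooth_has_derivative]]]
  unfolding along_def .

lemma along_scaleR:
  assumes "smooth f" "smooth g"
  shows "along X (\<lambda>q. f q *\<^sub>R g q) p = f p *\<^sub>R along X g p + along X f p *\<^sub>R g p"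
  using along_eqI[OF has_derivative_scaleR[OF assms[THEN smooth_has_derivative]]]
  unfolding along_def .

lemma connection_nabla1: "connection (nabla1 lam)"
proof -
  have add: "along (\<lambda>q. X q + X' q) Y p = along X Y p + along X' Y p" if "smooth Y"
    for X X' Y :: "r3 vfield" and p
    using linear_add[OF linear_frechet_derivative[OF smooth_differentiable[OF that]]]
    by (simp add: along_def)
  have scale: "along (\<lambda>q. \<phi> q *\<^sub>R X q) Y p = \<phi> p *\<^sub>R along X Y p" if "smooth Y"
    for \<phi> and X Y :: "r3 vfield" and p
    using linear_scale[OF linear_frechet_derivative[OF smooth_differentiable[OF that]]]
    by (simp add: along_def)
  have c: "christoffel1 lam p (u + u') v = christoffel1 lam p u v + christoffel1 lam p u' v"
    "christoffel1 lam p v (u + u') = christoffel1 lam p v u + christoffel1 lam p v u'"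
    "christoffel1 lam p (r *\<^sub>R u) v = r *\<^sub>R christoffel1 lam p u v"
    "christoffel1 lam p u (r *\<^sub>R v) = r *\<^sub>R christoffel1 lam p u v" for p u u' v r
    by (simp_all add: christoffel1_def case_prod_unfold algebra_simps)
  have sm: "smooth (\<lambda>p. along X Y p + (1 / 2) *\<^sub>R christoffel1 lam p (X p) (Y p))"
    if "smooth X" "smooth Y" for X Y
    using that by (intro smooth_add smooth_scaleR smooth_const smooth_christoffel1 smooth_along)
  show ?thesis
    unfolding connection_def
    by (intro conjI allI impI)
      (auto simp: nabla1_def sm smooth_add smooth_scaleR fun_eq_iff
        add scale c along_add along_scaleR scaleR_add_right scaleR_left_commute)
qed

lemma torsion_free_nabla1: "torsion_free (nabla1 lam)"
proof -
  have "christoffel1 lam p u v = christoffel1 lam p v u" for p u v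
    by (simp add: christoffel1_def case_prod_unfold mult.commute add.commute)
  then show ?thesis
    by (simp add: torsion_free_def nabla1_def lie_bracket_def)
qed

lemma g1_linear:
  "g1 lam p (u + u') v = g1 lam p u v + g1 lam p u' v"
  "g1 lam p v (u + u') = g1 lam p v u + g1 lam p v u'"
  "g1 lam p (r *\<^sub>R u) v = r * g1 lam p u v"
  "g1 lam p v (r *\<^sub>R u) = r * g1 lam p v u"
  by (simp_all add: g1_def case_prod_unfold divide_inverse algebra_simps)

lemma g1_christoffel1:
  assumes "lam \<noteq> 0"
  shows "g1 lam p (christoffel1 lam p u v) w + g1 lam p v (christoffel1 lam p u w)
    = 2 * fst u * (fst (snd v) * (fst p * fst (snd w) + snd (snd w))
        + (fst p * fst (snd v) + snd (snd v)) * fst (snd w))"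
proof -
  obtain x y z where p: "p = (x, y, z)" by (cases p)
  obtain u1 u2 u3 where u: "u = (u1, u2, u3)" by (cases u)
  obtain v1 v2 v3 where v: "v = (v1, v2, v3)" by (cases v)
  obtain w1 w2 w3 where w: "w = (w1, w2, w3)" by (cases w)
  have k: "(1 / lam\<^sup>2) * (lam\<^sup>2 * a * c) = a * c" "(1 / lam\<^sup>2) * (c * (lam\<^sup>2 * a)) = a * c" for a c
    using assms by simp_all
  show ?thesis
    unfolding p u v w christoffel1_def prod.case fst_conv snd_conv
      g1_def minus_mult_left[symmetric] k
    by (simp add: algebra_simps)
qed

lemma g1_has_derivative:
  assumes Y: "(Y has_derivative DY) (at p)" and Z: "(Z has_derivative DZ) (at p)"
  shows "((\<lambda>q. g1 lam q (Y q) (Z q)) has_derivative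
    (\<lambda>v. g1 lam p (DY v) (Z p) + g1 lam p (Y p) (DZ v)
      + fst v * (fst (snd (Y p)) * (fst p * fst (snd (Z p)) + snd (snd (Z p)))
        + (fst p * fst (snd (Y p)) + snd (snd (Y p))) * fst (snd (Z p))))) (at p)"
proof -
  define k where "k = - (1 / lam\<^sup>2)"
  note Y' = has_derivative_fst[OF Y] has_derivative_snd[OF Y]
  note Z' = has_derivative_fst[OF Z] has_derivative_snd[OF Z]
  note ds = Y'(1) Z'(1) has_derivative_fst[OF Y'(2)] has_derivative_snd[OF Y'(2)]
    has_derivative_fst[OF Z'(2)] has_derivative_snd[OF Z'(2)]
    has_derivative_fst[OF has_derivative_ident]
  show ?thesis
    unfolding g1_def case_prod_unfold k_def[symmetric]
    by (rule has_derivative_eq_rhs,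
        (rule has_derivative_add has_derivative_mult has_derivative_const ds)+)
      (simp add: fun_eq_iff algebra_simps)
qed

lemma metric_compatible_nabla1:
  assumes "lam \<noteq> 0"
  shows "metric_compatible (g1 lam) (nabla1 lam)"
  unfolding metric_compatible_def
proof (intro allI impI)
  fix X Y Z :: "r3 vfield" and p :: r3
  assume s: "smooth X" "smooth Y" "smooth Z"
  show "along X (\<lambda>q. g1 lam q (Y q) (Z q)) p
      = g1 lam p (nabla1 lam X Y p) (Z p) + g1 lam p (Y p) (nabla1 lam X Z p)"
  proof -
    have 1: "along X (\<lambda>q. g1 lam q (Y q) (Z q)) p
      = g1 lam p (along X Y p) (Z p) + g1 lam p (Y p) (along X Z p)
        + fst (X p) * (fst (snd (Y p)) * (fst p * fst (snd (Z p)) + snd (snd (Z p)))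
          + (fst p * fst (snd (Y p)) + snd (snd (Y p))) * fst (snd (Z p)))"
      using along_eqI[OF g1_has_derivative[OF s(2-3)[THEN smooth_has_derivative]]]
      unfolding along_def .
    have 2: "nabla1 lam X Y p = along X Y p + (1 / 2) *\<^sub>R christoffel1 lam p (X p) (Y p)"
      "nabla1 lam X Z p = along X Z p + (1 / 2) *\<^sub>R christoffel1 lam p (X p) (Z p)"
      using s by (simp_all add: nabla1_def)
    show ?thesis
      using g1_christoffel1[OF assms, of p "X p" "Y p" "Z p"]
      unfolding 1 2 g1_linear mult.assoc by linarith
  qed
qed

theorem levi_civita_g1:
  assumes "lam \<noteq> 0"
  shows "levi_civita (g1 lam) = nabla1 lam"
proof (rule levi_civita_eqI)
  show "g1 lam p u v = g1 lam p v u" for p u v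
    by (simp add: g1_def case_prod_unfold mult.commute)
  show "linear (g1 lam p u)" for p u
    by (rule linearI) (simp_all add: g1_linear)
  show "u = 0" if z: "\<And>v. g1 lam p u v = 0" for p u
    using z[of "(1, 0, 0)"] z[of "(0, 1, 0)"] z[of "(0, 0, 1)"] assms
    by (cases p; cases u; simp add: g1_def zero_prod_def)
  show "is_levi_civita (g1 lam) (nabla1 lam)"
    by (simp add: is_levi_civita_def connection_nabla1 torsion_free_nabla1
        metric_compatible_nabla1[OF assms])
  show "nabla1 lam X Y = (\<lambda>_. 0)" if "\<not> (smooth X \<and> smooth Y)" for X Y
    using that by (auto simp: nabla1_def)
qed

end

theory Submission
  imports Defs
begin

text \<open>Over the frame \<open>F\<^sub>i = e\<^sub>i / \<lambda>\<close> the Levi-Civita connection has constant coefficients that do not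
  involve \<open>\<lambda>\<close>, and \<open>[F\<^sub>2, F\<^sub>3] = F\<^sub>1\<close>. Let \<open>X\<close> be affine and expand
  \<open>[X, F\<^sub>j] = \<Sum>\<^sub>m P\<^sub>j\<^sub>m F\<^sub>m\<close>. Testing affinity on pairs of frame fields expresses every derivative
  \<open>F\<^sub>i P\<^sub>j\<^sub>m\<close> as a constant-coefficient linear combination of the \<open>P\<^sub>k\<^sub>l\<close>, and the integrability
  condition \<open>F\<^sub>2 F\<^sub>3 P - F\<^sub>3 F\<^sub>2 P = F\<^sub>1 P\<close> becomes linear algebra. It forces all \<open>P\<^sub>j\<^sub>m\<close> to vanish except
  \<open>P\<^sub>2\<^sub>3 = P\<^sub>3\<^sub>2\<close>, which is a constant, and the resulting first-order system for the
  components of \<open>X\<close> integrates to the stated polynomials. Conversely, for these polynomial fields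
  the second derivatives of the test fields cancel by Schwarz's theorem, which leaves a pointwise
  identity between Christoffel symbols and derivatives of \<open>X\<close>.\<close>

section \<open>Symmetry of second derivatives\<close>

lemma has_real_derivative_line:
  fixes f :: "'a::real_normed_vector \<Rightarrow> real"
  assumes "smooth f"
  shows "((\<lambda>s. f (c + s *\<^sub>R u)) has_real_derivative frechet_derivative f (at (c + s *\<^sub>R u)) u) (at s)"
proof -
  let ?D = "frechet_derivative f (at (c + s *\<^sub>R u))"
  have "((\<lambda>s. f (c + s *\<^sub>R u)) has_derivative (\<lambda>t. ?D (t *\<^sub>R u))) (at s)"
    by (rule has_derivative_compose[OF _ smooth_has_derivative[OF assms]])
      (auto intro!: derivative_eq_intros)
  moreover have "?D (t *\<^sub>R u) = ?D u * t" for t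
    using linear_scale[OF linear_frechet_derivative[OF smooth_differentiable[OF assms]]]
    by (simp add: mult.commute)
  ultimately show ?thesis
    by (simp add: has_field_derivative_def)
qed

text \<open>The mean value theorem is applied twice. The first use is in direction \<open>u\<close>,
  to the difference of \<open>f\<close> along two parallel lines that are
  \<open>h *\<^sub>R v\<close> apart. The second is in direction \<open>v\<close>, to the resulting
  difference of directional derivatives.\<close>

lemma mixed_difference_mean_value:
  fixes f :: "'a::real_normed_vector \<Rightarrow> real"
  assumes f: "smooth f" and h: "h > 0"
  obtains s t where "0 < s" "s < h" "0 < t" "t < h"
    "f (p + h *\<^sub>R u + h *\<^sub>R v) - f (p + h *\<^sub>R u) - f (p + h *\<^sub>R v) + f p
      = h\<^sup>2 * frechet_derivative (\<lambda>q. frechet_derivative f (at q) u) (at (p + s *\<^sub>R u + t *\<^sub>R v)) v"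
proof -
  let ?D = "\<lambda>q. frechet_derivative f (at q) u"
  let ?g = "\<lambda>s. f (p + h *\<^sub>R v + s *\<^sub>R u) - f (p + s *\<^sub>R u)"
  have "(?g has_real_derivative ?D (p + h *\<^sub>R v + s *\<^sub>R u) - ?D (p + s *\<^sub>R u)) (at s)" for s
    by (intro DERIV_diff has_real_derivative_line f)
  then obtain s where s: "0 < s" "s < h"
    "?g h - ?g 0 = (h - 0) * (?D (p + h *\<^sub>R v + s *\<^sub>R u) - ?D (p + s *\<^sub>R u))"
    using MVT2[OF h, of ?g "\<lambda>s. ?D (p + h *\<^sub>R v + s *\<^sub>R u) - ?D (p + s *\<^sub>R u)"] by blast
  obtain t where t: "0 < t" "t < h"
    "?D (p + s *\<^sub>R u + h *\<^sub>R v) - ?D (p + s *\<^sub>R u + 0 *\<^sub>R v)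
      = (h - 0) * frechet_derivative ?D (at (p + s *\<^sub>R u + t *\<^sub>R v)) v"
    using MVT2[OF h, of "\<lambda>t. ?D (p + s *\<^sub>R u + t *\<^sub>R v)"
        "\<lambda>t. frechet_derivative ?D (at (p + s *\<^sub>R u + t *\<^sub>R v)) v"]
      has_real_derivative_line[OF smooth_directional[OF f]] by blast
  have "?D (p + h *\<^sub>R v + s *\<^sub>R u) - ?D (p + s *\<^sub>R u)
      = h * frechet_derivative ?D (at (p + s *\<^sub>R u + t *\<^sub>R v)) v"
    using t(3) by (simp add: add_ac)
  with s(3) have "f (p + h *\<^sub>R u + h *\<^sub>R v) - f (p + h *\<^sub>R u) - f (p + h *\<^sub>R v) + f p
      = h\<^sup>2 * frechet_derivative ?D (at (p + s *\<^sub>R u + t *\<^sub>R v)) v"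
    by (simp add: add_ac power2_eq_square)
  then show thesis using that s t by blast
qed

text \<open>The mixed second difference is symmetric in \<open>u\<close> and \<open>v\<close>, so
  its two mean value forms agree at intermediate points. As the step \<open>1 / (n + 1)\<close>
  shrinks, these points tend to \<open>p\<close>, and continuity of the second derivatives gives
  equality there.\<close>

lemma frechet_derivative_commute_real:
  fixes f :: "'a::real_normed_vector \<Rightarrow> real"
  assumes f: "smooth f"
  shows "frechet_derivative (\<lambda>q. frechet_derivative f (at q) u) (at p) v
    = frechet_derivative (\<lambda>q. frechet_derivative f (at q) v) (at p) u"
proof -
  let ?D = "\<lambda>u v q. frechet_derivative (\<lambda>q. frechet_derivative f (at q) u) (at q) v"
  let ?h = "\<lambda>n. inverse (real (Suc n))"
  have "\<exists>s t s' t'. 0 < s \<and> s < ?h n \<and> 0 < t \<and> t < ?h n \<and> 0 < s' \<and> s' < ?h n \<and> 0 < t' \<and> t' < ?h n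
      \<and> ?D u v (p + s *\<^sub>R u + t *\<^sub>R v) = ?D v u (p + s' *\<^sub>R v + t' *\<^sub>R u)" for n
  proof -
    have h: "?h n > 0" by simp
    obtain s t where 1: "0 < s" "s < ?h n" "0 < t" "t < ?h n"
      "f (p + ?h n *\<^sub>R u + ?h n *\<^sub>R v) - f (p + ?h n *\<^sub>R u) - f (p + ?h n *\<^sub>R v) + f p
        = (?h n)\<^sup>2 * ?D u v (p + s *\<^sub>R u + t *\<^sub>R v)"
      by (rule mixed_difference_mean_value[OF f h])
    obtain s' t' where 2: "0 < s'" "s' < ?h n" "0 < t'" "t' < ?h n"
      "f (p + ?h n *\<^sub>R v + ?h n *\<^sub>R u) - f (p + ?h n *\<^sub>R v) - f (p + ?h n *\<^sub>R u) + f p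
        = (?h n)\<^sup>2 * ?D v u (p + s' *\<^sub>R v + t' *\<^sub>R u)"
      by (rule mixed_difference_mean_value[OF f h])
    have "(?h n)\<^sup>2 * ?D u v (p + s *\<^sub>R u + t *\<^sub>R v) = (?h n)\<^sup>2 * ?D v u (p + s' *\<^sub>R v + t' *\<^sub>R u)"
      unfolding 1(5)[symmetric] 2(5)[symmetric] by (simp add: add_ac)
    then have "?D u v (p + s *\<^sub>R u + t *\<^sub>R v) = ?D v u (p + s' *\<^sub>R v + t' *\<^sub>R u)"
      using h by simp
    then show ?thesis using 1 2 by blast
  qed
  then obtain s t s' t' where bd: "\<And>n. 0 < s n \<and> s n < ?h n" "\<And>n. 0 < t n \<and> t n < ?h n"
      "\<And>n. 0 < s' n \<and> s' n < ?h n" "\<And>n. 0 < t' n \<and> t' n < ?h n"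
    and eq: "\<And>n. ?D u v (p + s n *\<^sub>R u + t n *\<^sub>R v) = ?D v u (p + s' n *\<^sub>R v + t' n *\<^sub>R u)"
    by metis
  have zero: "r \<longlonglongrightarrow> 0" if "\<And>n. 0 < r n \<and> r n < ?h n" for r :: "nat \<Rightarrow> real"
    by (rule real_tendsto_sandwich[OF _ _ tendsto_const LIMSEQ_inverse_real_of_nat])
      (use that in \<open>auto intro!: always_eventually intro: less_imp_le simp del: of_nat_Suc\<close>)
  have lim: "(\<lambda>n. ?D a b (p + r n *\<^sub>R c + r' n *\<^sub>R d)) \<longlonglongrightarrow> ?D a b p"
    if "r \<longlonglongrightarrow> 0" "r' \<longlonglongrightarrow> 0" for r r' a b c d
  proof -
    have "smooth (?D a b)" by (intro smooth_directional f)
    then have "continuous (at p) (?D a b)"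
      by (intro differentiable_imp_continuous_within smooth_differentiable)
    moreover have "(\<lambda>n. p + r n *\<^sub>R c + r' n *\<^sub>R d) \<longlonglongrightarrow> p + 0 *\<^sub>R c + 0 *\<^sub>R d"
      by (intro tendsto_intros that)
    ultimately show ?thesis
      using isCont_tendsto_compose[of p "?D a b"] by simp
  qed
  show ?thesis
    using LIMSEQ_unique[OF lim[OF zero zero, OF bd(1,2), of u u v v, unfolded eq]
        lim[OF zero zero, OF bd(3,4), of v v u u]] .
qed

lemma frechet_derivative_commute:
  fixes f :: "'a::real_normed_vector \<Rightarrow> 'b::euclidean_space"
  assumes f: "smooth f"
  shows "frechet_derivative (\<lambda>q. frechet_derivative f (at q) u) (at p) v
    = frechet_derivative (\<lambda>q. frechet_derivative f (at q) v) (at p) u"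
proof (rule euclidean_eqI)
  fix b :: 'b assume "b \<in> Basis"
  have inner: "frechet_derivative (\<lambda>q. h q \<bullet> b) (at q) w = frechet_derivative h (at q) w \<bullet> b"
    if "smooth h" for h :: "'a \<Rightarrow> 'b" and q w
    using frechet_derivative_at[OF has_derivative_inner_left[OF smooth_has_derivative[OF that], of b]]
    by metis
  have "frechet_derivative (\<lambda>q. frechet_derivative f (at q) u \<bullet> b) (at p) v
      = frechet_derivative (\<lambda>q. frechet_derivative f (at q) v \<bullet> b) (at p) u"
    using frechet_derivative_commute_real[OF smooth_bounded_linear[OF bounded_linear_inner_left f],
        of b u p v]
    unfolding inner[OF f] .
  then show "frechet_derivative (\<lambda>q. frechet_derivative f (at q) u) (at p) v \<bullet> b
      = frechet_derivative (\<lambda>q. frechet_derivative f (at q) v) (at p) u \<bullet> b"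
    by (simp add: inner smooth_directional f)
qed

section \<open>Derivatives along vector fields and their commutator\<close>

lemma along_const [simp]: "along X (\<lambda>q. c) p = 0"
  by (simp add: along_def)

lemma along_expand:
  fixes X :: "'a::euclidean_space vfield"
  assumes f: "smooth f"
  shows "along X f p = (\<Sum>b\<in>Basis. (X p \<bullet> b) *\<^sub>R frechet_derivative f (at p) b)"
proof -
  interpret linear "frechet_derivative f (at p)"
    by (rule linear_frechet_derivative[OF smooth_differentiable[OF f]])
  have "frechet_derivative f (at p) (X p)
      = frechet_derivative f (at p) (\<Sum>b\<in>Basis. (X p \<bullet> b) *\<^sub>R b)"
    by (simp add: euclidean_representation)
  then show ?thesis
    unfolding along_def by (simp add: sum scale)
qed

lemma along_sum:
  "finite A \<Longrightarrow> (\<And>i. i \<in> A \<Longrightarrow> smooth (f i)) \<Longrightarrow>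
    along X (\<lambda>q. \<Sum>i\<in>A. f i q) p = (\<Sum>i\<in>A. along X (f i) p)"
  by (induction A rule: finite_induct) (simp_all add: along_add smooth_sum)

lemma along_bounded_linear:
  "bounded_linear L \<Longrightarrow> smooth f \<Longrightarrow> along X (\<lambda>q. L (f q)) p = L (along X f p)"
  using along_eqI[OF bounded_linear.has_derivative[OF _ smooth_has_derivative]]
  unfolding along_def by blast

text \<open>In coordinates \<open>X (Y f)\<close> splits into a part with first derivatives of
  \<open>f\<close>, whose coefficients are derivatives of \<open>Y\<close>, and a part with second
  derivatives. The second-order parts cancel by Schwarz's theorem, and the first-order parts combine
  to the bracket.\<close>

lemma along_commutator:
  fixes f :: "'a::euclidean_space \<Rightarrow> 'b::euclidean_space"
  assumes X: "smooth X" and Y: "smooth Y" and f: "smooth f"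
  shows "along X (along Y f) p - along Y (along X f) p = along (lie_bracket X Y) f p"
proof -
  let ?D = "\<lambda>b q. frechet_derivative f (at q) b"
  let ?DD = "\<lambda>b c. frechet_derivative (?D b) (at p) c"
  have second: "along U (along V f) p
      = (\<Sum>b\<in>Basis. (along U V p \<bullet> b) *\<^sub>R ?D b p)
        + (\<Sum>b\<in>Basis. \<Sum>c\<in>Basis. (V p \<bullet> b) *\<^sub>R (U p \<bullet> c) *\<^sub>R ?DD b c)"
    if "smooth U" "smooth V" for U V
  proof -
    have "along V f = (\<lambda>q. \<Sum>b\<in>Basis. (V q \<bullet> b) *\<^sub>R ?D b q)"
      using along_expand[OF f] by blast
    then have "along U (along V f) p = (\<Sum>b\<in>Basis. along U (\<lambda>q. (V q \<bullet> b) *\<^sub>R ?D b q) p)"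
      using that by (simp add: along_sum smooth_scaleR smooth_directional f
          smooth_bounded_linear[OF bounded_linear_inner_left])
    also have "\<dots> = (\<Sum>b\<in>Basis. (along U V p \<bullet> b) *\<^sub>R ?D b p + (V p \<bullet> b) *\<^sub>R along U (?D b) p)"
      using that by (simp add: along_scaleR smooth_directional f add.commute
          smooth_bounded_linear[OF bounded_linear_inner_left]
          along_bounded_linear[OF bounded_linear_inner_left])
    finally show ?thesis
      by (simp add: along_expand[OF smooth_directional[OF f]] sum.distrib scaleR_sum_right)
  qed
  have "(\<Sum>b\<in>Basis. \<Sum>c\<in>Basis. (Y p \<bullet> b) *\<^sub>R (X p \<bullet> c) *\<^sub>R ?DD b c)
      = (\<Sum>b\<in>Basis. \<Sum>c\<in>Basis. (X p \<bullet> b) *\<^sub>R (Y p \<bullet> c) *\<^sub>R ?DD b c)"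
    by (subst sum.swap) (simp add: frechet_derivative_commute[OF f] mult.commute)
  then show ?thesis
    by (simp add: second X Y along_expand[OF f, of "lie_bracket X Y"] lie_bracket_def
        inner_diff_left scaleR_diff_left sum_subtractf)
qed

section \<open>The polynomial fields are affine\<close>

lemma nabla1_eq:
  "smooth X \<Longrightarrow> smooth Y \<Longrightarrow>
    nabla1 lam X Y = (\<lambda>p. along X Y p + (1 / 2) *\<^sub>R christoffel1 lam p (X p) (Y p))"
  by (simp add: nabla1_def)

lemma christoffel1_diff:
  "christoffel1 lam p (u - u') v = christoffel1 lam p u v - christoffel1 lam p u' v"
  "christoffel1 lam p v (u - u') = christoffel1 lam p v u - christoffel1 lam p v u'"
  by (simp_all add: christoffel1_def case_prod_unfold algebra_simps)

text \<open>Derivative of the Christoffel map with respect to the base point, in the direction \<open>w\<close>.\<close>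

definition dchristoffel1 :: "real \<Rightarrow> r3 \<Rightarrow> r3 \<Rightarrow> r3 \<Rightarrow> r3 \<Rightarrow> r3" where
  "dchristoffel1 lam = (\<lambda>(x, y, z) (w1, w2, w3) (u1, u2, u3) (v1, v2, v3).
     (2 * lam\<^sup>2 * w1 * (u2 * v2),
      w1 * (u1 * v2 + u2 * v1),
      - 2 * x * w1 * (u1 * v2 + u2 * v1) - w1 * (u1 * v3 + u3 * v1)))"

lemma along_christoffel1:
  assumes "smooth Y" "smooth Z"
  shows "along X (\<lambda>q. christoffel1 lam q (Y q) (Z q)) p
    = christoffel1 lam p (along X Y p) (Z p) + christoffel1 lam p (Y p) (along X Z p)
      + dchristoffel1 lam p (X p) (Y p) (Z p)"
proof -
  let ?DY = "frechet_derivative Y (at p)" and ?DZ = "frechet_derivative Z (at p)"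
  note Y = smooth_has_derivative[OF assms(1), of p] and Z = smooth_has_derivative[OF assms(2), of p]
  note Y' = has_derivative_fst[OF Y] has_derivative_snd[OF Y]
  note Z' = has_derivative_fst[OF Z] has_derivative_snd[OF Z]
  note ds = Y'(1) Z'(1) has_derivative_fst[OF Y'(2)] has_derivative_snd[OF Y'(2)]
    has_derivative_fst[OF Z'(2)] has_derivative_snd[OF Z'(2)]
    has_derivative_fst[OF has_derivative_ident]
  have "((\<lambda>q. christoffel1 lam q (Y q) (Z q)) has_derivative
    (\<lambda>v. christoffel1 lam p (?DY v) (Z p) + christoffel1 lam p (Y p) (?DZ v)
      + dchristoffel1 lam p v (Y p) (Z p))) (at p)"
    unfolding christoffel1_def dchristoffel1_def case_prod_unfold
    by (rule has_derivative_eq_rhs,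
        (rule has_derivative_Pair has_derivative_add has_derivative_diff has_derivative_mult
            has_derivative_const ds)+)
      (simp add: fun_eq_iff algebra_simps)
  from along_eqI[OF this, of X] show ?thesis unfolding along_def .
qed

lemma along_diff:
  assumes "smooth f" "smooth g"
  shows "along X (\<lambda>q. f q - g q) p = along X f p - along X g p"
  using along_eqI[OF has_derivative_diff[OF assms[THEN smooth_has_derivative]]]
  unfolding along_def .

text \<open>The fields of the theorem in coordinates, with \<open>m = c\<^sub>1 / \<lambda>\<^sup>2\<close> to avoid division.\<close>

definition isometry_field :: "real \<Rightarrow> real \<Rightarrow> real \<Rightarrow> real \<Rightarrow> real \<Rightarrow> r3 vfield" where
  "isometry_field lam m c2 c3 c4 = (\<lambda>(x, y, z).
     (- (m * lam\<^sup>2 * y + c2), c3 - m * x, m * lam\<^sup>2 / 2 * y\<^sup>2 + m / 2 * x\<^sup>2 + c2 * y + c4))"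

lemma isometry_field_has_derivative:
  "(isometry_field lam m c2 c3 c4 has_derivative (\<lambda>v. (- (m * lam\<^sup>2 * fst (snd v)), - (m * fst v),
      m * lam\<^sup>2 * fst (snd p) * fst (snd v) + m * fst p * fst v + c2 * fst (snd v)))) (at p)"
  unfolding isometry_field_def case_prod_unfold
  by (auto intro!: derivative_eq_intros simp: fun_eq_iff algebra_simps power2_eq_square)

lemma smooth_isometry_field: "smooth (isometry_field lam m c2 c3 c4)"
  unfolding isometry_field_def case_prod_unfold power2_eq_square
  by (intro smooth_Pair smooth_add smooth_diff smooth_minus smooth_mult smooth_fst smooth_snd
      smooth_const smooth_ident)

text \<open>After expansion in coordinates, all terms containing derivatives of \<open>Y\<close> or
  \<open>Z\<close> match. What remains is the pointwise identity \<open>key\<close>, which says that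
  the Lie derivative of the connection along the field vanishes.\<close>

lemma affine_isometry_field:
  "affine_field (nabla1 lam) (isometry_field lam m c2 c3 c4)"
  unfolding affine_field_def
proof (intro conjI allI impI smooth_isometry_field)
  fix Y Z :: "r3 vfield" and p
  assume Y: "smooth Y" and Z: "smooth Z"
  define X where "X = isometry_field lam m c2 c3 c4"
  \<comment> \<open>\<open>L p\<close> is the first derivative of \<open>X\<close> at
    \<open>p\<close>, and \<open>H\<close> is its second derivative, which is independent of
    \<open>p\<close> because the coordinates of \<open>X\<close> are at most quadratic.\<close>
  define L :: "r3 \<Rightarrow> r3 \<Rightarrow> r3" where "L = (\<lambda>p v. (- (m * lam\<^sup>2 * fst (snd v)), - (m * fst v),
      m * lam\<^sup>2 * fst (snd p) * fst (snd v) + m * fst p * fst v + c2 * fst (snd v)))"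
  define H :: "r3 \<Rightarrow> r3 \<Rightarrow> r3" where
    "H = (\<lambda>u v. (0, 0, m * lam\<^sup>2 * fst (snd u) * fst (snd v) + m * fst u * fst v))"
  have X: "smooth X" by (simp add: X_def smooth_isometry_field)
  have L: "along V X = (\<lambda>q. L q (V q))" for V
    using along_eqI[OF isometry_field_has_derivative] by (auto simp: X_def L_def fun_eq_iff)
  have LL: "along Y (\<lambda>q. L q (Z q)) p = L p (along Y Z p) + H (Y p) (Z p)"
  proof -
    note D = smooth_has_derivative[OF Z, of p]
    note ds = has_derivative_fst[OF D] has_derivative_fst[OF has_derivative_snd[OF D]]
      has_derivative_fst[OF has_derivative_ident]
      has_derivative_fst[OF has_derivative_snd[OF has_derivative_ident]]
    have "((\<lambda>q. L q (Z q)) has_derivative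
      (\<lambda>v. L p (frechet_derivative Z (at p) v) + H v (Z p))) (at p)"
      unfolding L_def H_def
      by (rule has_derivative_eq_rhs,
          (rule has_derivative_Pair has_derivative_add has_derivative_minus has_derivative_mult
            has_derivative_const ds)+)
        (simp add: fun_eq_iff algebra_simps)
    from along_eqI[OF this, of Y] show ?thesis unfolding along_def .
  qed
  \<comment> \<open>The factor 2 on \<open>H\<close> appears because \<open>christoffel1\<close> is
    twice the Christoffel symbols.\<close>
  have key: "dchristoffel1 lam p (X p) u v - L p (christoffel1 lam p u v)
      = - christoffel1 lam p (L p u) v - christoffel1 lam p u (L p v) - 2 *\<^sub>R H u v" for u v
    by (cases p; cases u; cases v)
      (simp add: X_def isometry_field_def L_def H_def christoffel1_def dchristoffel1_def
        algebra_simps power2_eq_square)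
  have linL: "L p (u + r *\<^sub>R v) = L p u + r *\<^sub>R L p v" for u v r
    by (simp add: L_def algebra_simps)
  have sC: "smooth (\<lambda>q. (1/2) *\<^sub>R christoffel1 lam q (Y q) (Z q))"
    by (intro smooth_scaleR smooth_const smooth_christoffel1 Y Z)
  have lhs: "lie_bracket X (nabla1 lam Y Z) p
      = along X (along Y Z) p
        + (1/2) *\<^sub>R (christoffel1 lam p (along X Y p) (Z p) + christoffel1 lam p (Y p) (along X Z p)
            + dchristoffel1 lam p (X p) (Y p) (Z p))
        - L p (along Y Z p) - (1/2) *\<^sub>R L p (christoffel1 lam p (Y p) (Z p))"
    unfolding lie_bracket_def L
    by (simp add: nabla1_eq Y Z along_add[OF smooth_along[OF Y Z] sC] linL along_christoffel1
        along_scaleR smooth_const smooth_christoffel1)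
  \<comment> \<open>The derivative of \<open>Z\<close> along the bracket is written as a commutator
    here, so that its second derivatives cancel against those in \<open>lhs\<close> and
    \<open>r2\<close>.\<close>
  have r1: "nabla1 lam (lie_bracket X Y) Z p
      = along X (along Y Z) p - along Y (along X Z) p
        + (1/2) *\<^sub>R christoffel1 lam p (along X Y p - L p (Y p)) (Z p)"
    unfolding along_commutator[OF X Y Z]
    by (simp add: nabla1_eq smooth_lie_bracket X Y Z) (simp add: lie_bracket_def L)
  have "lie_bracket X Z = (\<lambda>q. along X Z q - along Z X q)"
    by (simp add: lie_bracket_def fun_eq_iff)
  then have "along Y (lie_bracket X Z) p
      = along Y (along X Z) p - L p (along Y Z p) - H (Y p) (Z p)"
    by (simp add: along_diff smooth_along X Z) (simp add: L LL)
  then have r2: "nabla1 lam Y (lie_bracket X Z) p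
      = along Y (along X Z) p - L p (along Y Z p) - H (Y p) (Z p)
        + (1/2) *\<^sub>R christoffel1 lam p (Y p) (along X Z p - L p (Z p))"
    by (simp add: nabla1_eq smooth_lie_bracket X Y Z) (simp add: lie_bracket_def L)
  have key': "dchristoffel1 lam p (X p) (Y p) (Z p)
      = L p (christoffel1 lam p (Y p) (Z p)) - christoffel1 lam p (L p (Y p)) (Z p)
        - christoffel1 lam p (Y p) (L p (Z p)) - 2 *\<^sub>R H (Y p) (Z p)"
    using key[of "Y p" "Z p"] by (simp add: algebra_simps)
  show "lie_bracket (isometry_field lam m c2 c3 c4) (nabla1 lam Y Z) p
      = nabla1 lam (lie_bracket (isometry_field lam m c2 c3 c4) Y) Z p
        + nabla1 lam Y (lie_bracket (isometry_field lam m c2 c3 c4) Z) p"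
    unfolding X_def[symmetric] lhs r1 r2 key' christoffel1_diff
    by (simp add: algebra_simps)
qed

section \<open>Affine fields in the left-invariant frame\<close>

text \<open>The factor \<open>1 / \<lambda>\<close> removes \<open>\<lambda>\<close> from the connection coefficients \<open>conn\<close> below. Only the
  indices \<open>1, 2, 3\<close> are meaningful.\<close>

definition frame :: "real \<Rightarrow> nat \<Rightarrow> r3 vfield" where
  "frame lam i p = (1 / lam) *\<^sub>R (if i = 1 then e1 p else if i = 2 then e2 p else e3 lam p)"

definition coframe :: "real \<Rightarrow> nat \<Rightarrow> r3 \<Rightarrow> r3 \<Rightarrow> real" where
  "coframe lam i p v = (if i = 1 then lam * (fst p * fst (snd v) + snd (snd v))
     else if i = 2 then lam * fst (snd v) else fst v)"

text \<open>\<open>conn i j k\<close> is the coefficient of \<open>F\<^sub>k\<close> in the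
  derivative of \<open>F\<^sub>j\<close> along \<open>F\<^sub>i\<close>. It is symmetric in
  \<open>i\<close> and \<open>j\<close> except for the opposite signs at \<open>(2,3,1)\<close> and
  \<open>(3,2,1)\<close>, which reflect \<open>[F\<^sub>2, F\<^sub>3] = F\<^sub>1\<close>.\<close>

definition conn :: "nat \<Rightarrow> nat \<Rightarrow> nat \<Rightarrow> real" where
  "conn i j k = (if (i, j, k) \<in> {(1,2,3), (2,1,3), (1,3,2), (3,1,2), (2,3,1)} then 1 / 2
     else if (i, j, k) = (3,2,1) then - 1 / 2 else 0)"

abbreviation idx :: "nat set" where "idx \<equiv> {1, 2, 3}"

lemma coframe_linear:
  "coframe lam i p (u + v) = coframe lam i p u + coframe lam i p v"
  "coframe lam i p (u - v) = coframe lam i p u - coframe lam i p v"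
  "coframe lam i p (r *\<^sub>R u) = r * coframe lam i p u"
  "coframe lam i p (- u) = - coframe lam i p u"
  "coframe lam i p 0 = 0"
  by (simp_all add: coframe_def algebra_simps)

lemma coframe_sum: "coframe lam i p (\<Sum>k\<in>A. f k) = (\<Sum>k\<in>A. coframe lam i p (f k))"
  by (induction A rule: infinite_finite_induct) (simp_all add: coframe_linear)

lemma coframe_frame:
  assumes "lam \<noteq> 0" "i \<in> idx" "j \<in> idx"
  shows "coframe lam i p (frame lam j p) = (if i = j then 1 else 0)"
  using assms by (cases p) (auto simp: coframe_def frame_def e1_def e2_def e3_def)

lemma frame_expansion:
  assumes "lam \<noteq> 0"
  shows "v = (\<Sum>k\<in>idx. coframe lam k p v *\<^sub>R frame lam k p)"
  using assms by (cases p; cases v) (simp add: coframe_def frame_def e1_def e2_def e3_def field_simps)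

lemma smooth_frame: "smooth (frame lam i)"
proof -
  have "smooth e1" "smooth e2" "smooth (e3 lam)"
    unfolding e1_def e2_def e3_def case_prod_unfold
    by (intro smooth_Pair smooth_minus smooth_fst smooth_const smooth_ident)+
  then have "smooth (\<lambda>p. (1 / lam) *\<^sub>R e1 p)" "smooth (\<lambda>p. (1 / lam) *\<^sub>R e2 p)"
    "smooth (\<lambda>p. (1 / lam) *\<^sub>R e3 lam p)"
    by (auto intro!: smooth_scaleR smooth_const)
  then show ?thesis
    unfolding frame_def[abs_def] by (cases "i = 1"; cases "i = 2") auto
qed

lemma smooth_coframe: "smooth V \<Longrightarrow> smooth (\<lambda>p. coframe lam i p (V p))"
  unfolding coframe_def
  by (cases "i = 1"; cases "i = 2")
    (simp; intro smooth_mult smooth_add smooth_fst smooth_snd smooth_const smooth_ident; simp)+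

lemma frame_has_derivative:
  "(frame lam i has_derivative (\<lambda>v. if i = 2 then (0, 0, - (fst v / lam)) else 0)) (at p)"
  unfolding frame_def[abs_def] e1_def e2_def e3_def case_prod_unfold
  by (cases "i = 1"; cases "i = 2")
    (auto intro!: derivative_eq_intros simp: zero_prod_def fun_eq_iff divide_inverse mult.commute)

lemma along_frame: "along V (frame lam i) p = (if i = 2 then (0, 0, - (fst (V p) / lam)) else 0)"
  by (rule along_eqI[OF frame_has_derivative])

lemma lie_bracket_frame_23: "lam \<noteq> 0 \<Longrightarrow> lie_bracket (frame lam 2) (frame lam 3) p = frame lam 1 p"
  by (cases p) (simp add: lie_bracket_def along_frame frame_def e1_def e2_def e3_def)

text \<open>Constant coefficients are expected from left invariance. In this frame the metric is
  diag(1, 1, -1) divided by \<open>lam\<^sup>2\<close>, and a constant factor of the metric does not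
  change its connection, so \<open>lam\<close> drops out.\<close>

lemma nabla1_frame:
  assumes "lam \<noteq> 0" "i \<in> idx" "j \<in> idx"
  shows "nabla1 lam (frame lam i) (frame lam j) = (\<lambda>p. \<Sum>k\<in>idx. conn i j k *\<^sub>R frame lam k p)"
proof
  fix p
  show "nabla1 lam (frame lam i) (frame lam j) p = (\<Sum>k\<in>idx. conn i j k *\<^sub>R frame lam k p)"
    using assms
    by (cases p) (auto simp: nabla1_eq smooth_frame along_frame frame_def e1_def e2_def e3_def
        christoffel1_def conn_def field_simps power2_eq_square zero_prod_def)
qed

section \<open>Connection, bracket and differential over frame expansions\<close>

lemma nabla1_sum_left:
  assumes "finite A" "\<And>k. k \<in> A \<Longrightarrow> smooth (\<phi> k :: r3 \<Rightarrow> real)" "\<And>k. k \<in> A \<Longrightarrow> smooth (V k)" "smooth Z"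
  shows "nabla1 lam (\<lambda>p. \<Sum>k\<in>A. \<phi> k p *\<^sub>R V k p) Z p = (\<Sum>k\<in>A. \<phi> k p *\<^sub>R nabla1 lam (V k) Z p)"
  using assms(1-3)
proof (induction A rule: finite_induct)
  case empty
  have "christoffel1 lam p 0 (Z p) = 0"
    by (simp add: christoffel1_def case_prod_unfold zero_prod_def)
  then show ?case
    using linear_0[OF linear_frechet_derivative[OF smooth_differentiable[OF assms(4)]]]
    by (simp add: nabla1_def along_def)
next
  case (insert a A)
  have s: "smooth (\<lambda>p. \<phi> a p *\<^sub>R V a p)" "smooth (\<lambda>p. \<Sum>k\<in>A. \<phi> k p *\<^sub>R V k p)"
    using insert by (auto intro!: smooth_scaleR smooth_sum)
  have "nabla1 lam (\<lambda>p. \<phi> a p *\<^sub>R V a p + (\<Sum>k\<in>A. \<phi> k p *\<^sub>R V k p)) Z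
      = (\<lambda>p. \<phi> a p *\<^sub>R nabla1 lam (V a) Z p + nabla1 lam (\<lambda>p. \<Sum>k\<in>A. \<phi> k p *\<^sub>R V k p) Z p)"
    using connection_nabla1[of lam] s assms(4) insert.prems unfolding connection_def by simp
  then show ?case using insert by simp
qed

lemma nabla1_sum_right:
  assumes "finite A" "\<And>k. k \<in> A \<Longrightarrow> smooth (\<phi> k :: r3 \<Rightarrow> real)" "\<And>k. k \<in> A \<Longrightarrow> smooth (V k)" "smooth Y"
  shows "nabla1 lam Y (\<lambda>p. \<Sum>k\<in>A. \<phi> k p *\<^sub>R V k p) p
    = (\<Sum>k\<in>A. along Y (\<phi> k) p *\<^sub>R V k p + \<phi> k p *\<^sub>R nabla1 lam Y (V k) p)"
  using assms(1-3)
proof (induction A rule: finite_induct)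
  case empty
  have "christoffel1 lam p (Y p) 0 = 0"
    by (simp add: christoffel1_def case_prod_unfold zero_prod_def)
  then show ?case
    by (simp add: nabla1_def)
next
  case (insert a A)
  have s: "smooth (\<lambda>p. \<phi> a p *\<^sub>R V a p)" "smooth (\<lambda>p. \<Sum>k\<in>A. \<phi> k p *\<^sub>R V k p)"
    using insert by (auto intro!: smooth_scaleR smooth_sum)
  have "nabla1 lam Y (\<lambda>p. \<phi> a p *\<^sub>R V a p + (\<Sum>k\<in>A. \<phi> k p *\<^sub>R V k p))
      = (\<lambda>p. (along Y (\<phi> a) p *\<^sub>R V a p + \<phi> a p *\<^sub>R nabla1 lam Y (V a) p)
           + nabla1 lam Y (\<lambda>p. \<Sum>k\<in>A. \<phi> k p *\<^sub>R V k p) p)"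
    using connection_nabla1[of lam] s assms(4) insert.prems unfolding connection_def by simp
  then show ?case using insert by simp
qed

lemma lie_bracket_sum_const:
  assumes "finite A" "smooth X" "\<And>k. k \<in> A \<Longrightarrow> smooth (V k)"
  shows "lie_bracket X (\<lambda>p. \<Sum>k\<in>A. c k *\<^sub>R V k p) p = (\<Sum>k\<in>A. c k *\<^sub>R lie_bracket X (V k) p)"
proof -
  interpret linear "frechet_derivative X (at p)"
    by (rule linear_frechet_derivative[OF smooth_differentiable[OF assms(2)]])
  have "along X (\<lambda>p. \<Sum>k\<in>A. c k *\<^sub>R V k p) p = (\<Sum>k\<in>A. c k *\<^sub>R along X (V k) p)"
    using assms by (simp add: along_sum along_scaleR smooth_scaleR smooth_const)
  then show ?thesis
    unfolding lie_bracket_def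
    by (simp add: along_def[of _ X] sum scale scaleR_diff_right sum_subtractf)
qed

lemma lie_bracket_scaleR_left:
  assumes "smooth \<phi>" "smooth V" "smooth W"
  shows "lie_bracket (\<lambda>p. \<phi> p *\<^sub>R V p) W p = \<phi> p *\<^sub>R lie_bracket V W p - along W \<phi> p *\<^sub>R V p"
proof -
  interpret linear "frechet_derivative W (at p)"
    by (rule linear_frechet_derivative[OF smooth_differentiable[OF assms(3)]])
  show ?thesis
    unfolding lie_bracket_def
    by (simp add: along_scaleR assms) (simp add: along_def scale algebra_simps)
qed

lemma lie_bracket_add_left:
  assumes "smooth U" "smooth V" "smooth W"
  shows "lie_bracket (\<lambda>p. U p + V p) W p = lie_bracket U W p + lie_bracket V W p"
proof -
  interpret linear "frechet_derivative W (at p)"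
    by (rule linear_frechet_derivative[OF smooth_differentiable[OF assms(3)]])
  show ?thesis
    unfolding lie_bracket_def
    by (simp add: along_add assms) (simp add: along_def add algebra_simps)
qed

text \<open>The frame spans every tangent space, so the three frame derivatives determine the
  differential. This carries equations found in the frame back to coordinates.\<close>

lemma frechet_derivative_frame:
  fixes f :: "r3 \<Rightarrow> real"
  assumes lam: "lam \<noteq> 0" and f: "smooth f"
  shows "frechet_derivative f (at p) = (\<lambda>v. \<Sum>k\<in>idx. coframe lam k p v * along (frame lam k) f p)"
proof
  fix v
  interpret linear "frechet_derivative f (at p)"
    by (rule linear_frechet_derivative[OF smooth_differentiable[OF f]])
  have "frechet_derivative f (at p) v
      = frechet_derivative f (at p) (\<Sum>k\<in>idx. coframe lam k p v *\<^sub>R frame lam k p)"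
    using frame_expansion[OF lam] by metis
  then show "frechet_derivative f (at p) v = (\<Sum>k\<in>idx. coframe lam k p v * along (frame lam k) f p)"
    by (simp only: along_def sum scale real_scaleR_def)
qed

text \<open>A difference with zero derivative on the whole space is constant. First-order systems
  are integrated below by exhibiting one solution \<open>g\<close>.\<close>

lemma antiderivative_unique:
  fixes f g :: "'a::real_normed_vector \<Rightarrow> real"
  assumes f: "smooth f" and g: "\<And>p. (g has_derivative frechet_derivative f (at p)) (at p)"
  obtains c where "\<And>p. f p = g p + c"
proof -
  have "((\<lambda>p. f p - g p) has_derivative (\<lambda>v. 0)) (at p)" for p
    using has_derivative_diff[OF smooth_has_derivative[OF f] g] by simp
  then obtain c where "\<And>p. f p - g p = c"
    using has_derivative_zero_constant[of UNIV "\<lambda>p. f p - g p"] by auto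
  then have "f p = g p + c" for p by (simp add: algebra_simps)
  then show thesis by (rule that)
qed

section \<open>The linear differential system for the bracket coefficients\<close>

definition ad_coeff :: "real \<Rightarrow> r3 vfield \<Rightarrow> nat \<Rightarrow> nat \<Rightarrow> r3 \<Rightarrow> real" where
  "ad_coeff lam X j m p = coframe lam m p (lie_bracket X (frame lam j) p)"

lemma smooth_ad_coeff: "smooth X \<Longrightarrow> smooth (ad_coeff lam X j m)"
  unfolding ad_coeff_def[abs_def] by (intro smooth_coframe smooth_lie_bracket smooth_frame)

text \<open>The \<open>m\<close>-th frame component of
  \<open>[X, \<nabla>\<^bsub>F i\<^esub> F j] - \<nabla>\<^bsub>[X, F i]\<^esub> F j - \<nabla>\<^bsub>F i\<^esub> [X, F j]\<close> with the derivative of \<open>P j m\<close> left out,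
  where \<open>P\<close> are the coefficients of \<open>[X, F j]\<close>.\<close>

definition aff_sys :: "(nat \<Rightarrow> nat \<Rightarrow> r3 \<Rightarrow> real) \<Rightarrow> nat \<Rightarrow> nat \<Rightarrow> nat \<Rightarrow> r3 \<Rightarrow> real" where
  "aff_sys P i j m p = (\<Sum>k\<in>idx. conn i j k * P k m p - conn k j m * P i k p - conn i k m * P j k p)"

text \<open>In the \<open>m\<close>-th frame component of the affinity equation for
  \<open>F\<^sub>i\<close> and \<open>F\<^sub>j\<close>, the Leibniz rule leaves a single
  derivative, that of \<open>P\<^sub>j\<^sub>m\<close> along \<open>F\<^sub>i\<close>. Solving for
  it gives the system.\<close>

lemma along_ad_coeff:
  assumes lam: "lam \<noteq> 0" and X: "affine_field (nabla1 lam) X" and ijm: "i \<in> idx" "j \<in> idx" "m \<in> idx"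
  shows "along (frame lam i) (ad_coeff lam X j m) p = aff_sys (ad_coeff lam X) i j m p"
proof -
  let ?F = "frame lam" and ?P = "ad_coeff lam X"
  note F = smooth_frame[of lam]
  have sX: "smooth X" using X by (simp add: affine_field_def)
  note sP = smooth_ad_coeff[OF sX, of lam]
  have P: "lie_bracket X (?F j) = (\<lambda>p. \<Sum>k\<in>idx. ?P j k p *\<^sub>R ?F k p)" for j
    using frame_expansion[OF lam] unfolding ad_coeff_def by blast
  have "lie_bracket X (nabla1 lam (?F i) (?F j)) p
      = nabla1 lam (lie_bracket X (?F i)) (?F j) p + nabla1 lam (?F i) (lie_bracket X (?F j)) p"
    using X F unfolding affine_field_def by blast
  also have "lie_bracket X (nabla1 lam (?F i) (?F j)) p
      = (\<Sum>k\<in>idx. conn i j k *\<^sub>R lie_bracket X (?F k) p)"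
    using ijm by (simp only: nabla1_frame[OF lam] lie_bracket_sum_const[OF _ sX F] finite.intros)
  also have "nabla1 lam (lie_bracket X (?F i)) (?F j) p
      = (\<Sum>k\<in>idx. ?P i k p *\<^sub>R nabla1 lam (?F k) (?F j) p)"
    unfolding P by (intro nabla1_sum_left sP F finite.intros)
  also have "nabla1 lam (?F i) (lie_bracket X (?F j)) p
      = (\<Sum>k\<in>idx. along (?F i) (?P j k) p *\<^sub>R ?F k p + ?P j k p *\<^sub>R nabla1 lam (?F i) (?F k) p)"
    unfolding P by (intro nabla1_sum_right sP F finite.intros)
  finally have "coframe lam m p (\<Sum>k\<in>idx. conn i j k *\<^sub>R lie_bracket X (?F k) p)
      = coframe lam m p ((\<Sum>k\<in>idx. ?P i k p *\<^sub>R nabla1 lam (?F k) (?F j) p)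
        + (\<Sum>k\<in>idx. along (?F i) (?P j k) p *\<^sub>R ?F k p + ?P j k p *\<^sub>R nabla1 lam (?F i) (?F k) p))"
    by (rule arg_cong)
  moreover have "coframe lam m p (nabla1 lam (?F k) (?F l) p) = conn k l m" if "k \<in> idx" "l \<in> idx" for k l
    unfolding nabla1_frame[OF lam that] coframe_sum coframe_linear
    using ijm(3) by (auto simp: coframe_frame[OF lam])
  ultimately have "(\<Sum>k\<in>idx. conn i j k * ?P k m p)
      = (\<Sum>k\<in>idx. ?P i k p * conn k j m)
        + (\<Sum>k\<in>idx. along (?F i) (?P j k) p * (if m = k then 1 else 0) + ?P j k p * conn i k m)"
    using ijm by (simp only: coframe_sum coframe_linear ad_coeff_def[symmetric] coframe_frame[OF lam]
        cong: sum.cong)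
  then show ?thesis
    using ijm(3) by (auto simp: aff_sys_def algebra_simps)
qed

text \<open>The coefficients \<open>conn\<close> are constants, so differentiation passes to the
  entries of \<open>P\<close>.\<close>

lemma along_aff_sys_commute:
  assumes "\<And>j m. smooth (P j m)"
  shows "along V (aff_sys P i j m) p = aff_sys (\<lambda>j m. along V (P j m)) i j m p"
proof -
  have c: "along V (\<lambda>q. c * P j m q) p = c * along V (P j m) p" for c j m
    using along_scaleR[OF smooth_const assms] by simp
  show ?thesis
    unfolding aff_sys_def[abs_def]
    by (simp add: along_add along_diff smooth_add smooth_diff smooth_mult smooth_const assms c)
qed

text \<open>Substituting the system twice into the commutator identity for
  \<open>[F\<^sub>2, F\<^sub>3] = F\<^sub>1\<close> removes every derivative. A linear relation
  between the values of \<open>P\<close> at the single point \<open>p\<close> is left.\<close>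

lemma aff_sys_integrable:
  assumes lam: "lam \<noteq> 0" and X: "affine_field (nabla1 lam) X" and jm: "j \<in> idx" "m \<in> idx"
  defines "P \<equiv> ad_coeff lam X"
  shows "aff_sys (aff_sys P 2) 3 j m p - aff_sys (aff_sys P 3) 2 j m p = aff_sys P 1 j m p"
proof -
  have sX: "smooth X" using X by (simp add: affine_field_def)
  note sP = smooth_ad_coeff[OF sX, of lam, folded P_def]
  note eq = along_ad_coeff[OF lam X, folded P_def]
  have D: "along (frame lam i) (P j m) = aff_sys P i j m" if "i \<in> idx" "j \<in> idx" "m \<in> idx" for i j m
    using eq[OF that] by blast
  \<comment> \<open>The order reverses: the outer derivative \<open>l\<close> passes through the
    constant coefficients of the system for \<open>i\<close> and acts on \<open>P\<close>
    inside.\<close>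
  have DD: "along (frame lam l) (along (frame lam i) (P j m)) p = aff_sys (aff_sys P l) i j m p"
    if "i \<in> idx" "l \<in> idx" for i l
  proof -
    have "along (frame lam l) (along (frame lam i) (P j m)) p
        = aff_sys (\<lambda>j m. along (frame lam l) (P j m)) i j m p"
      unfolding D[OF that(1) jm] by (rule along_aff_sys_commute[OF sP])
    also have "\<dots> = aff_sys (aff_sys P l) i j m p"
      using that jm unfolding aff_sys_def[of _ i j m] by (intro sum.cong refl) (simp only: D)
    finally show ?thesis .
  qed
  have "lie_bracket (frame lam 2) (frame lam 3) = frame lam 1"
    using lie_bracket_frame_23[OF lam] by blast
  then show ?thesis
    using along_commutator[OF smooth_frame smooth_frame sP, of lam 2 lam 3 j m p] DD D[of 1 j m] jm
    by simp
qed

text \<open>Geometrically, bracketing with \<open>X\<close> acts on the frame as an infinitesimal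
  Lorentz boost in the plane of \<open>F\<^sub>2\<close> (spacelike) and \<open>F\<^sub>3\<close>
  (timelike), with constant rate \<open>t\<close>.\<close>

lemma affine_field_bracket_frame:
  assumes lam: "lam \<noteq> 0" and X: "affine_field (nabla1 lam) X"
  obtains t where "\<And>p. lie_bracket X (frame lam 1) p = 0"
    "\<And>p. lie_bracket X (frame lam 2) p = t *\<^sub>R frame lam 3 p"
    "\<And>p. lie_bracket X (frame lam 3) p = t *\<^sub>R frame lam 2 p"
proof -
  define P where "P = ad_coeff lam X"
  note I = aff_sys_integrable[OF lam X, folded P_def]
  note simps = aff_sys_def conn_def
  \<comment> \<open>The relations for all index pairs except (1,1) and (3,3) are solved as linear
    equations in the entries of \<open>P\<close> at \<open>p\<close>.\<close>
  have "P 2 1 p = 0 \<and> P 3 1 p = 0 \<and> P 2 2 p = 0 \<and> P 3 3 p = 0 \<and> P 2 3 p = P 3 2 p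
      \<and> P 1 2 p = 0 \<and> P 1 3 p = 0" for p
    using I[of 1 2 p] I[of 1 3 p] I[of 2 1 p] I[of 3 1 p] I[of 2 2 p] I[of 2 3 p] I[of 3 2 p]
    unfolding simps by (simp add: add_divide_distrib diff_divide_distrib)
  then have z: "P 1 2 = (\<lambda>_. 0)" "P 1 3 = (\<lambda>_. 0)" "P 2 1 = (\<lambda>_. 0)" "P 3 1 = (\<lambda>_. 0)"
    "P 2 2 = (\<lambda>_. 0)" "P 3 3 = (\<lambda>_. 0)" "P 2 3 = P 3 2" by auto
  note eq = along_ad_coeff[OF lam X, folded P_def]
  \<comment> \<open>The entry \<open>P 1 1\<close> comes from the differential system itself:
    \<open>P 2 1\<close> vanishes identically, and its derivative along \<open>F\<^sub>3\<close>
    equals \<open>- P 1 1 / 2\<close> once the entries in \<open>z\<close> are zero.\<close>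
  have "P 1 1 p = 0" for p
    using eq[of 3 2 1 p] by (simp add: simps z del: One_nat_def)
  then have a1: "P 1 1 = (\<lambda>_. 0)" by auto
  have sX: "smooth X" using X by (simp add: affine_field_def)
  note sP = smooth_ad_coeff[OF sX, of lam, folded P_def]
  have "along (frame lam i) (P 3 2) p = 0" if "i \<in> idx" for i p
    using that eq[of i 3 2 p] by (auto simp: simps z a1 simp del: One_nat_def)
  \<comment> \<open>All three frame derivatives of \<open>P 3 2\<close> vanish, hence so does its
    differential, and the entry is a constant \<open>t\<close>.\<close>
  then have "((\<lambda>_. 0) has_derivative frechet_derivative (P 3 2) (at p)) (at p)" for p
    using frechet_derivative_frame[OF lam sP, of 3 2 p] by simp
  then obtain t where "\<And>p. P 3 2 p = 0 + t"
    using antiderivative_unique[OF sP] by blast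
  then have t: "P 3 2 = (\<lambda>p. t)" by auto
  have P: "lie_bracket X (frame lam j) p = (\<Sum>k\<in>idx. P j k p *\<^sub>R frame lam k p)" for j p
    using frame_expansion[OF lam] unfolding P_def ad_coeff_def by blast
  show thesis
    by (rule that[of t]) (simp_all add: P z a1 t del: One_nat_def)
qed

section \<open>From the brackets to the components of the field\<close>

lemma frechet_derivative_components:
  fixes f1 f2 f3 :: "r3 \<Rightarrow> real"
  assumes lam: "lam \<noteq> 0" and sm: "smooth f1" "smooth f2" "smooth f3"
    and X: "X = (\<lambda>p. f1 p *\<^sub>R e1 p + f2 p *\<^sub>R e2 p + f3 p *\<^sub>R e3 lam p)"
    and br: "\<And>p. lie_bracket X (frame lam 1) p = 0"
    "\<And>p. lie_bracket X (frame lam 2) p = t *\<^sub>R frame lam 3 p"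
    "\<And>p. lie_bracket X (frame lam 3) p = t *\<^sub>R frame lam 2 p"
  shows "frechet_derivative f1 (at p) v = f2 p * fst v - lam * f3 p * fst (snd v)"
    "frechet_derivative f2 (at p) v = - (t / lam) * fst v"
    "frechet_derivative f3 (at p) v = - t * fst (snd v)"
proof -
  \<comment> \<open>These are the components of \<open>X\<close> over \<open>frame\<close>; the
    factor \<open>lam\<close> undoes the \<open>1 / lam\<close> there.\<close>
  define \<phi> where "\<phi> k p = lam * (if k = 1 then f1 p else if k = 2 then f2 p else f3 p)" for k :: nat and p
  let ?F = "frame lam"
  have s\<phi>: "smooth (\<phi> k)" for k
    unfolding \<phi>_def by (cases "k = 1"; cases "k = 2") (auto intro!: smooth_mult smooth_const sm)
  have "X = (\<lambda>p. \<phi> 1 p *\<^sub>R ?F 1 p + \<phi> 2 p *\<^sub>R ?F 2 p + \<phi> 3 p *\<^sub>R ?F 3 p)"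
    using lam by (simp add: X \<phi>_def frame_def)
  then have Xb: "lie_bracket X (?F j) p = (\<phi> 1 p *\<^sub>R lie_bracket (?F 1) (?F j) p - along (?F j) (\<phi> 1) p *\<^sub>R ?F 1 p)
    + (\<phi> 2 p *\<^sub>R lie_bracket (?F 2) (?F j) p - along (?F j) (\<phi> 2) p *\<^sub>R ?F 2 p)
    + (\<phi> 3 p *\<^sub>R lie_bracket (?F 3) (?F j) p - along (?F j) (\<phi> 3) p *\<^sub>R ?F 3 p)" for j
    by (simp add: lie_bracket_add_left lie_bracket_scaleR_left smooth_add smooth_scaleR s\<phi> smooth_frame)
  have FF: "lie_bracket (?F i) (?F j) p = (if (i, j) = (2, 3) then ?F 1 p else if (i, j) = (3, 2) then - ?F 1 p else 0)"
    if "i \<in> idx" "j \<in> idx" for i j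
    using that lam by (cases p)
      (auto simp: lie_bracket_def along_frame frame_def e1_def e2_def e3_def zero_prod_def)
  have co: "coframe lam k p (lie_bracket X (?F j) p)
    = coframe lam k p (if j = 1 then 0 else if j = 2 then t *\<^sub>R ?F 3 p else t *\<^sub>R ?F 2 p)" if "j \<in> idx" for j k
    using that br[of p] by auto
  \<comment> \<open>Frame components of the two expressions for \<open>[X, F\<^sub>j]\<close> are
    compared. The entries with \<open>\<phi> 2\<close> and \<open>\<phi> 3\<close> come from
    \<open>[F\<^sub>2, F\<^sub>3] = F\<^sub>1\<close>, those with \<open>t\<close> from the assumed
    brackets.\<close>
  have D\<phi>: "along (?F j) (\<phi> k) p =
      (if (j, k) = (2, 1) then - \<phi> 3 p else if (j, k) = (3, 1) then \<phi> 2 p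
       else if (j, k) = (2, 3) \<or> (j, k) = (3, 2) then - t else 0)" if "j \<in> idx" "k \<in> idx" for j k
    using co[OF that(1), of k] that lam unfolding Xb
    by (auto simp: FF coframe_linear coframe_frame[OF lam] split: if_splits)
  have scale: "frechet_derivative (\<phi> k) (at p) v = lam * frechet_derivative f (at p) v"
    if "\<phi> k = (\<lambda>p. lam * f p)" "smooth f" for k f
    unfolding that(1)
    using frechet_derivative_at[OF has_derivative_mult_right[OF smooth_has_derivative[OF that(2)], of lam]]
    by metis
  have "frechet_derivative (\<phi> k) (at p) v = (\<Sum>j\<in>idx. coframe lam j p v * along (?F j) (\<phi> k) p)" for k
    using frechet_derivative_frame[OF lam s\<phi>] by simp
  note D = this[of 1] this[of 2] this[of 3]
  have \<phi>: "\<phi> 1 = (\<lambda>p. lam * f1 p)" "\<phi> 2 = (\<lambda>p. lam * f2 p)" "\<phi> 3 = (\<lambda>p. lam * f3 p)"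
    by (simp_all add: \<phi>_def fun_eq_iff)
  have "frechet_derivative (\<phi> 1) (at p) v = \<phi> 2 p * fst v - lam * \<phi> 3 p * fst (snd v)"
    "frechet_derivative (\<phi> 2) (at p) v = - t * fst v"
    "frechet_derivative (\<phi> 3) (at p) v = - (lam * t) * fst (snd v)"
    by (simp_all add: D D\<phi> coframe_def del: One_nat_def)
  note E = this[unfolded scale[OF \<phi>(1) sm(1)] scale[OF \<phi>(2) sm(2)] scale[OF \<phi>(3) sm(3)]]
  show "frechet_derivative f1 (at p) v = f2 p * fst v - lam * f3 p * fst (snd v)"
    "frechet_derivative f2 (at p) v = - (t / lam) * fst v"
    "frechet_derivative f3 (at p) v = - t * fst (snd v)"
    by (rule mult_left_cancel[OF lam, THEN iffD1]; simp only: E; simp add: \<phi> lam algebra_simps)+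
qed

theorem theorem3p4:
  fixes lam :: real and f1 f2 f3 :: "real \<times> real \<times> real \<Rightarrow> real"
  assumes "lam \<noteq> 0" and "smooth f1" and "smooth f2" and "smooth f3"
  shows "affine_field (levi_civita (g1 lam))
           (\<lambda>p. f1 p *\<^sub>R e1 p + f2 p *\<^sub>R e2 p + f3 p *\<^sub>R e3 lam p)
     \<longleftrightarrow> (\<exists>c1 c2 c3 c4 :: real. \<forall>x y z.
           f1 (x, y, z) = c1 / 2 * y\<^sup>2 - c1 / (2 * lam\<^sup>2) * x\<^sup>2 + c3 * x + c2 * y + c4 \<and>
           f2 (x, y, z) = - (c1 / lam\<^sup>2) * x + c3 \<and>
           f3 (x, y, z) = - (1 / lam) * (c1 * y + c2))"
  unfolding levi_civita_g1[OF assms(1)]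
proof
  let ?X = "\<lambda>p. f1 p *\<^sub>R e1 p + f2 p *\<^sub>R e2 p + f3 p *\<^sub>R e3 lam p"
  assume "affine_field (nabla1 lam) ?X"
  then obtain t where t: "\<And>p. lie_bracket ?X (frame lam 1) p = 0"
    "\<And>p. lie_bracket ?X (frame lam 2) p = t *\<^sub>R frame lam 3 p"
    "\<And>p. lie_bracket ?X (frame lam 3) p = t *\<^sub>R frame lam 2 p"
    using affine_field_bracket_frame[OF assms(1)] by blast
  note D = frechet_derivative_components[OF assms refl t]
  have "((\<lambda>p. - t * fst (snd p)) has_derivative frechet_derivative f3 (at p)) (at p)" for p
    by (auto intro!: derivative_eq_intros simp: D fun_eq_iff assms(1))
  then obtain k3 where f3: "\<And>p. f3 p = - t * fst (snd p) + k3"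
    using antiderivative_unique[OF assms(4)] by blast
  have "((\<lambda>p. - (t / lam) * fst p) has_derivative frechet_derivative f2 (at p)) (at p)" for p
    by (auto intro!: derivative_eq_intros simp: D fun_eq_iff assms(1))
  then obtain k2 where f2: "\<And>p. f2 p = - (t / lam) * fst p + k2"
    using antiderivative_unique[OF assms(3)] by blast
  \<comment> \<open>The differential of \<open>f1\<close> is \<open>f2 dx - lam f3 dy\<close>. By
    now \<open>f2\<close> depends on \<open>x\<close> only and \<open>f3\<close> on \<open>y\<close>
    only, so each term is integrated separately.\<close>
  have "((\<lambda>p. - (t / lam) / 2 * (fst p)\<^sup>2 + k2 * fst p + lam * t / 2 * (fst (snd p))\<^sup>2
      - lam * k3 * fst (snd p)) has_derivative frechet_derivative f1 (at p)) (at p)" for p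
    by (auto intro!: derivative_eq_intros simp: D f2 f3 fun_eq_iff algebra_simps assms(1))
  then obtain k1 where f1: "\<And>p. f1 p = - (t / lam) / 2 * (fst p)\<^sup>2 + k2 * fst p
      + lam * t / 2 * (fst (snd p))\<^sup>2 - lam * k3 * fst (snd p) + k1"
    using antiderivative_unique[OF assms(2)] by blast
  show "\<exists>c1 c2 c3 c4 :: real. \<forall>x y z.
           f1 (x, y, z) = c1 / 2 * y\<^sup>2 - c1 / (2 * lam\<^sup>2) * x\<^sup>2 + c3 * x + c2 * y + c4 \<and>
           f2 (x, y, z) = - (c1 / lam\<^sup>2) * x + c3 \<and>
           f3 (x, y, z) = - (1 / lam) * (c1 * y + c2)"
    \<comment> \<open>The first two witnesses are read off from \<open>f3\<close>, the third from
      \<open>f2\<close>, and the fourth is the integration constant of \<open>f1\<close>.\<close>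
    by (rule exI[of _ "lam * t"], rule exI[of _ "- lam * k3"], rule exI[of _ k2], rule exI[of _ k1])
      (use assms(1) in \<open>simp add: f1 f2 f3 field_simps power2_eq_square\<close>)
next
  let ?X = "\<lambda>p. f1 p *\<^sub>R e1 p + f2 p *\<^sub>R e2 p + f3 p *\<^sub>R e3 lam p"
  assume "\<exists>c1 c2 c3 c4 :: real. \<forall>x y z.
           f1 (x, y, z) = c1 / 2 * y\<^sup>2 - c1 / (2 * lam\<^sup>2) * x\<^sup>2 + c3 * x + c2 * y + c4 \<and>
           f2 (x, y, z) = - (c1 / lam\<^sup>2) * x + c3 \<and>
           f3 (x, y, z) = - (1 / lam) * (c1 * y + c2)"
  then obtain c1 c2 c3 c4 where f:
    "f1 (x, y, z) = c1 / 2 * y\<^sup>2 - c1 / (2 * lam\<^sup>2) * x\<^sup>2 + c3 * x + c2 * y + c4"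
    "f2 (x, y, z) = - (c1 / lam\<^sup>2) * x + c3"
    "f3 (x, y, z) = - (1 / lam) * (c1 * y + c2)" for x y z
    by blast
  \<comment> \<open>Since \<open>e2\<close> has \<open>z\<close>-component \<open>- x\<close>, the
    third coordinate of the field is \<open>f1 - x * f2\<close>. This cancels the term
    \<open>c3 * x\<close> and turns the coefficient of \<open>x\<^sup>2\<close> into
    \<open>m / 2\<close> with \<open>m = c1 / lam\<^sup>2\<close>.\<close>
  have "?X p = isometry_field lam (c1 / lam\<^sup>2) c2 c3 c4 p" for p
    using assms(1)
    by (cases p) (simp add: f isometry_field_def e1_def e2_def e3_def field_simps power2_eq_square)
  then show "affine_field (nabla1 lam) ?X"
    using affine_isometry_field by presburger
qed

end
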